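(* Let $r=2/\sqrt{3}-1$ and let $R\subset\mathbb{R}^2$ be a closed rectangle with sides $2+4r$ and $1+3r$. There exist a real number $d$ with $0<d<\sqrt{3}\,r$ and a rigid motion $g$ of the plane (a composition of a rotation and a translation) such that the set $X=R\cap g(H_d)$ has exactly $55$ points and, for every packing of unit disks in the plane, at least one point of $X$ lies in no disk of the packing.
   Context: For $d>0$, $H_d$ denotes the hexagonal lattice in $\mathbb{R}^2$ with minimum distance $d$, i.e. the set of all integer linear combinations of the vectors $(d,0)$ and $(d/2,\sqrt{3}\,d/2)$. A unit disk is a closed disk of radius $1$ in $\mathbb{R}^2$. A packing of unit disks is a (finite or infinite) collection of unit disks that do not overlap, i.e. have pairwise disjoint interiors (equivalently, distinct disks have centers at distance at least $2$); tangent disks are allowed. *)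

theory Defs
  imports "HOL-Analysis.Analysis"
begin

definition hex_lattice :: "real \<Rightarrow> (real^2) set" where
  "hex_lattice d =
     {of_int a *\<^sub>R vector [d, 0] + of_int b *\<^sub>R vector [d / 2, sqrt 3 * d / 2] | a b :: int. True}"

text \<open>Rectangles may be placed and oriented arbitrarily in the plane.\<close>

definition closed_rectangle :: "real \<Rightarrow> real \<Rightarrow> (real^2) set \<Rightarrow> bool" where
  "closed_rectangle a b R \<longleftrightarrow>
     (\<exists>p u v. norm u = 1 \<and> norm v = 1 \<and> orthogonal u v \<and>
        R = {p + s *\<^sub>R u + t *\<^sub>R v | s t. s \<in> {0..a} \<and> t \<in> {0..b}})"

text \<open>Rotations have determinant 1, so reflections are excluded.\<close>

definition rigid_motion :: "(real^2 \<Rightarrow> real^2) \<Rightarrow> bool" where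
  "rigid_motion g \<longleftrightarrow> (\<exists>A t. rotation_matrix A \<and> g = (\<lambda>x. A *v x + t))"

definition unit_disk :: "(real^2) set \<Rightarrow> bool" where
  "unit_disk D \<longleftrightarrow> (\<exists>c. D = cball c 1)"

definition unit_disk_packing :: "(real^2) set set \<Rightarrow> bool" where
  "unit_disk_packing P \<longleftrightarrow>
     (\<forall>D\<in>P. unit_disk D) \<and> pairwise (\<lambda>D E. interior D \<inter> interior E = {}) P"

end

theory Submission
  imports Defs
begin

text \<open>
  Put \<open>\<rho> = 1 + r = 2 / sqrt 3\<close>, the circumradius of an equilateral triangle of side 2. A unit
  disk comes no nearer than \<open>r\<close> to a point outside it exactly when its centre is at distance at least
  \<open>\<rho>\<close> from the point. A hexagonal lattice with minimum distance \<open>d\<close> has a point within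
  \<open>d / sqrt 3\<close> of any given point (\<open>hex_lattice_close\<close>), and \<open>d / sqrt 3 < r\<close>. So it is enough to find, in the rectangle shrunk by
  \<open>r\<close> on every side, a point \<open>x\<close> at distance at least \<open>\<rho>\<close> from all centres of the packing: the
  lattice point near \<open>x\<close> then still lies in the large rectangle and in no disk. The shrunk rectangle
  has sides \<open>\<rho>\<close> and \<open>2 * \<rho>\<close>, and the existence of \<open>x\<close> is \<open>separated_disks_leave_hole\<close>.

  To prove it, suppose that the open disks of radius \<open>\<rho>\<close> around the centres cover the shrunk
  rectangle. Three centres at mutual distance at least \<open>2 = sqrt 3 * \<rho>\<close> never lie within distance
  less than \<open>\<rho>\<close> of one point (\<open>no_three_close_centres\<close>), so the Voronoi diagram of the centres has
  no vertex in the rectangle. Each Voronoi edge that meets the rectangle is therefore a full chord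
  of it, and the chord is shorter than \<open>\<rho>\<close> because its points are within \<open>\<rho>\<close> of two centres that are
  far apart (\<open>bisector_in_cell\<close>, \<open>bisector_short\<close>). Such chords only cut off corners: the cell of
  the midpoint of the rectangle still touches both short sides (\<open>cell_reaches_side\<close>). It then
  contains two points at distance at least \<open>2 * \<rho>\<close>, although it lies in an open disk of radius \<open>\<rho>\<close>.

  It remains to place a lattice with exactly 55 points in the large rectangle. With \<open>d = 4 / 15\<close> and
  lattice rows parallel to the side \<open>1 + 3 * r\<close>, eleven rows fit, and a shift by \<open>d / 4\<close> along the
  rows makes every row meet the rectangle in five points, whereas without it every second row
  would have six.
\<close>

section \<open>Points close to several centres\<close>

text \<open>
  The squared distances between three points sum to at most three times their squared distances to
  any fourth point \<open>x\<close>, with equality when \<open>x\<close> is their centroid. Here the first sum is at least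
  \<open>9 * \<rho>\<^sup>2\<close> and the second one is smaller than \<open>3 * \<rho>\<^sup>2\<close>.
\<close>

lemma no_three_close_centres:
  fixes x :: "'a::real_inner"
  assumes "0 < \<rho>"
    and sep: "sqrt 3 * \<rho> \<le> dist a b" "sqrt 3 * \<rho> \<le> dist b c" "sqrt 3 * \<rho> \<le> dist a c"
    and close: "dist x a < \<rho>" "dist x b < \<rho>" "dist x c < \<rho>"
  shows False
proof -
  have far: "3 * \<rho>\<^sup>2 \<le> (dist y z)\<^sup>2" if "sqrt 3 * \<rho> \<le> dist y z" for y z :: 'a
    using power_mono[OF that, of 2] \<open>0 < \<rho>\<close> by (simp add: power_mult_distrib)
  have near: "(dist x y)\<^sup>2 < \<rho>\<^sup>2" if "dist x y < \<rho>" for y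
    using that by (simp add: power_strict_mono)
  have "(norm (a - b))\<^sup>2 + (norm (b - c))\<^sup>2 + (norm (a - c))\<^sup>2 + (norm ((x - a) + (x - b) + (x - c)))\<^sup>2
      = 3 * ((norm (x - a))\<^sup>2 + (norm (x - b))\<^sup>2 + (norm (x - c))\<^sup>2)"
    by (simp add: power2_norm_eq_inner inner_simps inner_commute)
  then have "(dist a b)\<^sup>2 + (dist b c)\<^sup>2 + (dist a c)\<^sup>2
      \<le> 3 * ((dist x a)\<^sup>2 + (dist x b)\<^sup>2 + (dist x c)\<^sup>2)"
    unfolding dist_norm by (smt (verit) zero_le_power2)
  then show False
    using far[OF sep(1)] far[OF sep(2)] far[OF sep(3)] near[OF close(1)] near[OF close(2)] near[OF close(3)]
    by (smt (verit))
qed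

text \<open>
  A lens formed by two balls of radius \<open>\<rho>\<close> whose centres are at least \<open>sqrt 3 * \<rho>\<close> apart fits into the
  ball of diameter \<open>\<rho>\<close> around the midpoint of the centres, by Apollonius' median formula.
\<close>

lemma bisector_points_close:
  fixes x y :: "'a::real_inner"
  assumes "0 < \<rho>" and sep: "sqrt 3 * \<rho> \<le> dist c c'"
    and x: "dist x c < \<rho>" "dist x c' < \<rho>"
    and y: "dist y c < \<rho>" "dist y c' < \<rho>"
  shows "dist x y < \<rho>"
proof -
  have half: "dist z (midpoint c c') < \<rho> / 2" if "dist z c < \<rho>" "dist z c' < \<rho>" for z
  proof -
    have "3 * \<rho>\<^sup>2 \<le> (dist c c')\<^sup>2"
      using power_mono[OF sep, of 2] \<open>0 < \<rho>\<close> by (simp add: power_mult_distrib)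
    moreover have "(dist z c)\<^sup>2 < \<rho>\<^sup>2" "(dist z c')\<^sup>2 < \<rho>\<^sup>2"
      using that by (simp_all add: power_strict_mono)
    moreover have "(2 * norm (z - midpoint c c'))\<^sup>2 + (norm (c - c'))\<^sup>2
        = 2 * (norm (z - c))\<^sup>2 + 2 * (norm (z - c'))\<^sup>2"
    proof -
      have "2 * norm (z - midpoint c c') = norm ((z - c) + (z - c'))"
      proof -
        have "(z - c) + (z - c') = 2 *\<^sub>R (z - midpoint c c')"
          by (simp add: midpoint_def algebra_simps scaleR_2)
        then show ?thesis by simp
      qed
      moreover have "(norm ((z - c) + (z - c')))\<^sup>2 + (norm (c - c'))\<^sup>2
          = 2 * (norm (z - c))\<^sup>2 + 2 * (norm (z - c'))\<^sup>2"
        by (simp add: power2_norm_eq_inner inner_simps inner_commute)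
      ultimately show ?thesis by simp
    qed
    ultimately have "(2 * dist z (midpoint c c'))\<^sup>2 < \<rho>\<^sup>2"
      unfolding dist_norm by linarith
    then show ?thesis
      using power2_less_imp_less[of "2 * dist z (midpoint c c')" \<rho>] \<open>0 < \<rho>\<close> by simp
  qed
  show ?thesis
    using half[OF x] half[OF y] dist_triangle2[of x y "midpoint c c'"] by linarith
qed

section \<open>Voronoi cells of a hypothetical covering\<close>

text \<open>
  The assumption to be refuted for the rectangle, stated for any compact convex region.
\<close>

locale separated_cover =
  fixes \<rho> :: real and C K :: "'a::real_inner set"
  assumes rho_pos: "0 < \<rho>"
    and separated: "c \<in> C \<Longrightarrow> c' \<in> C \<Longrightarrow> c \<noteq> c' \<Longrightarrow> sqrt 3 * \<rho> \<le> dist c c'"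
    and compact_K: "compact K" and convex_K: "convex K"
    and covered: "x \<in> K \<Longrightarrow> \<exists>c\<in>C. dist x c < \<rho>"
begin

definition voronoi_cell :: "'a \<Rightarrow> 'a set" where
  "voronoi_cell c = {x \<in> K. \<forall>c'\<in>C. dist x c \<le> dist x c'}"

lemma at_most_two:
  assumes "a \<in> C" "b \<in> C" "c \<in> C" "dist x a < \<rho>" "dist x b < \<rho>" "dist x c < \<rho>" "a \<noteq> b"
  shows "c = a \<or> c = b"
  using no_three_close_centres[OF rho_pos, of a b c x] separated assms by blast

lemma dist_cell_less:
  assumes "x \<in> voronoi_cell c" shows "dist x c < \<rho>"
  using assms covered[of x] unfolding voronoi_cell_def by fastforce

lemma compact_cell: "compact (voronoi_cell c)"
proof -
  have "voronoi_cell c = K \<inter> (\<Inter>c'\<in>C. {x. dist x c \<le> dist x c'})"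
    by (auto simp: voronoi_cell_def)
  moreover have "closed (\<Inter>c'\<in>C. {x. dist x c \<le> dist x c'})"
    by (intro closed_INT ballI closed_Collect_le continuous_intros)
  ultimately show ?thesis
    using compact_K by (simp add: compact_Int_closed)
qed

lemma ex_cell:
  assumes "x \<in> K" shows "\<exists>c\<in>C. x \<in> voronoi_cell c"
proof -
  obtain a where a: "a \<in> C" "dist x a < \<rho>" using covered[OF assms] by blast
  show ?thesis
  proof (cases "x \<in> voronoi_cell a")
    case False
    then obtain b where b: "b \<in> C" "dist x b < dist x a"
      using assms by (auto simp: voronoi_cell_def not_le)
    have "dist x b \<le> dist x c" if "c \<in> C" for c
      using at_most_two[of a b c x] a b that by fastforce
    then show ?thesis using assms b by (auto simp: voronoi_cell_def)
  qed (use a in blast)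
qed

text \<open>
  A Voronoi edge cannot end inside \<open>K\<close>. Moving from \<open>p\<close> along the bisector of \<open>c\<close> and \<open>c'\<close>, the
  distance to \<open>c\<close> and \<open>c'\<close> would otherwise reach \<open>\<rho>\<close> at some point \<open>z\<close>. A third centre covers \<open>z\<close>,
  hence also points slightly before \<open>z\<close>, and these are then close to three centres. Being closer
  than \<open>\<rho>\<close> to \<open>c\<close> and \<open>c'\<close>, the points of the bisector have no other centre that near.
\<close>

lemma bisector_in_cell:
  assumes c: "c \<in> C" "c' \<in> C" "c \<noteq> c'"
    and p: "p \<in> voronoi_cell c" "dist p c = dist p c'"
    and q: "q \<in> K" "dist q c = dist q c'"
  shows "q \<in> voronoi_cell c"
proof -
  have pK: "p \<in> K" using p by (simp add: voronoi_cell_def)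
  have pc: "dist p c < \<rho>" using dist_cell_less p by blast
  have "dist q c < \<rho>"
  proof (rule ccontr)
    assume "\<not> dist q c < \<rho>"
    define f where "f t = p + t *\<^sub>R (q - p)" for t :: real
    have f_alt: "f t = (1 - t) *\<^sub>R p + t *\<^sub>R q" for t
      by (simp add: f_def algebra_simps)
    have fK: "f t \<in> K" if "0 \<le> t" "t \<le> 1" for t
      using convexD[OF convex_K pK q(1), of "1 - t" t] that by (simp add: f_alt)
    have fbis: "dist (f t) c = dist (f t) c'" for t
    proof -
      have e: "dist y c = dist y c' \<longleftrightarrow> 2 * inner y (c - c') = inner c c - inner c' c'" for y
        by (auto simp: dist_norm norm_eq inner_simps inner_commute)
      have "inner (f t) (c - c') = (1 - t) * inner p (c - c') + t * inner q (c - c')"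
        by (simp add: f_alt inner_add_left)
      moreover have "2 * inner p (c - c') = inner c c - inner c' c'"
        "2 * inner q (c - c') = inner c c - inner c' c'"
        using p(2) q(2) by (simp_all only: e)
      ultimately show ?thesis unfolding e by algebra
    qed
    have "continuous_on {0..1} (\<lambda>t. dist (f t) c)"
      unfolding f_def by (intro continuous_intros)
    moreover have "dist (f 0) c \<le> \<rho>" "\<rho> \<le> dist (f 1) c"
      using pc \<open>\<not> dist q c < \<rho>\<close> by (simp_all add: f_def)
    ultimately obtain t where t: "0 \<le> t" "t \<le> 1" "dist (f t) c = \<rho>"
      using IVT'[of "\<lambda>t. dist (f t) c" 0 \<rho> 1] by auto
    define z where "z = f t"
    have z: "z \<in> K" "dist z c = \<rho>" "dist z c' = \<rho>"
      using t fK fbis[of t] by (auto simp: z_def)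
    obtain c'' where c'': "c'' \<in> C" "dist z c'' < \<rho>"
      using covered[OF z(1)] by blast
    have "t \<noteq> 0" using t(3) pc by (auto simp: f_def)
    have "isCont (\<lambda>s. dist (f s) c'') t"
      unfolding f_def by (intro continuous_intros)
    then have "eventually (\<lambda>s. dist (f s) c'' < \<rho>) (at_left t)"
      using c''(2) order_tendstoD(2)[of "\<lambda>s. dist (f s) c''" _ "at t"]
      unfolding isCont_def z_def eventually_at_split by blast
    moreover have "eventually (\<lambda>s. 0 < s \<and> s < t) (at_left t)"
      using \<open>t \<noteq> 0\<close> t(1) unfolding eventually_at_left_field
      by (intro exI[of _ 0]) simp
    ultimately have "eventually (\<lambda>s. dist (f s) c'' < \<rho> \<and> 0 < s \<and> s < t) (at_left t)"
      by (rule eventually_conj)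
    then obtain s where s: "dist (f s) c'' < \<rho>" "0 < s" "s < t"
      using eventually_happens[of _ "at_left t"] trivial_limit_at_left_real by blast
    have "dist (f s) c < \<rho>"
    proof -
      define k where "k = s / t"
      have l: "0 \<le> k" "k < 1" using s by (auto simp: k_def)
      have "f s - c = (1 - k) *\<^sub>R (p - c) + k *\<^sub>R (z - c)"
      proof -
        have "s = k * t" using s by (simp add: k_def)
        then show ?thesis by (simp add: z_def f_def algebra_simps)
      qed
      then have "dist (f s) c \<le> (1 - k) * dist p c + k * dist z c"
        unfolding dist_norm using norm_triangle_ineq[of "(1 - k) *\<^sub>R (p - c)" "k *\<^sub>R (z - c)"] l by simp
      also have "\<dots> < (1 - k) * \<rho> + k * \<rho>"
        using l pc z(2) by (intro add_less_le_mono mult_strict_left_mono) auto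
      finally show ?thesis by (simp add: algebra_simps)
    qed
    then have "c'' = c \<or> c'' = c'"
      using at_most_two[of c c' c'' "f s"] c c'' s fbis[of s] by simp
    then show False using z c'' by auto
  qed
  moreover have "dist q c \<le> dist q c''" if "c'' \<in> C" for c''
  proof (rule ccontr)
    assume "\<not> dist q c \<le> dist q c''"
    then show False
      using at_most_two[of c c' c'' q] c that q(2) \<open>dist q c < \<rho>\<close> by auto
  qed
  ultimately show ?thesis using q by (simp add: voronoi_cell_def)
qed

text \<open>
  The chord of the bisector stays in the cell, so all its points lie in the lens around \<open>c\<close> and \<open>c'\<close>.
\<close>

lemma bisector_short:
  assumes c: "c \<in> C" "c' \<in> C" "c \<noteq> c'"
    and p: "p \<in> voronoi_cell c" "dist p c = dist p c'"
    and q: "q \<in> K" "dist q c = dist q c'"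
    and q': "q' \<in> K" "dist q' c = dist q' c'"
  shows "dist q q' < \<rho>"
proof -
  have "dist q c < \<rho>" "dist q' c < \<rho>"
    by (rule dist_cell_less[OF bisector_in_cell[OF c p q]])
       (rule dist_cell_less[OF bisector_in_cell[OF c p q']])
  then show ?thesis
    using bisector_points_close[OF rho_pos separated[OF c]] q(2) q'(2) by simp
qed

text \<open>
  At most one centre other than \<open>c\<close> is within \<open>\<rho>\<close> of \<open>p\<close>, so if \<open>c\<close> were strictly nearest to \<open>p\<close>, it
  would be nearest by a positive margin, even among infinitely many centres. By this margin it would
  stay nearest on a neighbourhood of \<open>p\<close>.
\<close>

lemma cell_boundary_tie:
  assumes c: "c \<in> C" and p: "p \<in> voronoi_cell c"
    and bd: "\<And>\<epsilon>. 0 < \<epsilon> \<Longrightarrow> \<exists>y\<in>K - voronoi_cell c. dist p y < \<epsilon>"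
  shows "\<exists>c'\<in>C. c \<noteq> c' \<and> dist p c = dist p c'"
proof (rule ccontr)
  assume no: "\<not> ?thesis"
  have pc: "dist p c < \<rho>" using dist_cell_less p by blast
  have strict: "dist p c < dist p c'" if "c' \<in> C" "c' \<noteq> c" for c'
    using p no that by (force simp: voronoi_cell_def)
  have "\<exists>\<epsilon>>0. \<forall>c'\<in>C. c' \<noteq> c \<longrightarrow> dist p c + 2 * \<epsilon> \<le> dist p c'"
  proof (cases "\<exists>c1\<in>C. c1 \<noteq> c \<and> dist p c1 < \<rho>")
    case True
    then obtain c1 where c1: "c1 \<in> C" "c1 \<noteq> c" "dist p c1 < \<rho>" by blast
    have "dist p c1 \<le> dist p c'" if "c' \<in> C" "c' \<noteq> c" for c'
      using at_most_two[of c c1 c' p] c c1 that pc by fastforce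
    then show ?thesis
      using strict[OF c1(1,2)] by (intro exI[of _ "(dist p c1 - dist p c) / 2"]) (auto simp: field_simps)
  next
    case False
    then show ?thesis using pc by (intro exI[of _ "(\<rho> - dist p c) / 2"]) (auto simp: not_less field_simps)
  qed
  then obtain \<epsilon> where e: "\<epsilon> > 0" "\<And>c'. c' \<in> C \<Longrightarrow> c' \<noteq> c \<Longrightarrow> dist p c + 2 * \<epsilon> \<le> dist p c'"
    by blast
  obtain y where y: "y \<in> K" "y \<notin> voronoi_cell c" "dist p y < \<epsilon>" using bd[OF e(1)] by blast
  then obtain c' where c': "c' \<in> C" "dist y c' < dist y c" by (auto simp: voronoi_cell_def not_le)
  then have "dist p c + 2 * \<epsilon> \<le> dist p c'" using e(2) by fastforce
  then show False
    using c' y(3) dist_triangle[of p c' y] dist_triangle[of y c p] dist_commute[of y p] by linarith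
qed

end

section \<open>Disks around separated centres leave a hole in a rectangle\<close>

text \<open>
  If a line cannot be followed upwards from a point below the top side, it is horizontal or the point
  lies on a vertical side. A horizontal chord has the full width \<open>\<rho>\<close>. In the other case the line,
  followed downwards, crosses the rectangle to the opposite vertical side or descends by \<open>\<rho>\<close>,
  whichever comes first; there is room for this descent because the point is in the upper half.
\<close>

lemma line_in_rectangle:
  fixes x y w1 w2 \<rho> :: real
  assumes "0 < \<rho>" and x: "\<bar>x\<bar> \<le> \<rho> / 2" and y: "0 \<le> y" "y < \<rho>" and w: "w1 \<noteq> 0 \<or> w2 \<noteq> 0"
  shows "(\<exists>s. \<bar>x + s * w1\<bar> \<le> \<rho> / 2 \<and> \<bar>y + s * w2\<bar> \<le> \<rho> \<and> y < y + s * w2)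
    \<or> (\<exists>s s'. \<bar>x + s * w1\<bar> \<le> \<rho> / 2 \<and> \<bar>y + s * w2\<bar> \<le> \<rho>
          \<and> \<bar>x + s' * w1\<bar> \<le> \<rho> / 2 \<and> \<bar>y + s' * w2\<bar> \<le> \<rho>
          \<and> \<rho>\<^sup>2 \<le> ((s - s') * w1)\<^sup>2 + ((s - s') * w2)\<^sup>2)"
proof -
  show ?thesis
  proof (cases "w2 = 0")
    case True
    then have "w1 \<noteq> 0" using w by simp
    show ?thesis
      using y \<open>w1 \<noteq> 0\<close> True \<open>0 < \<rho>\<close>
      by (intro disjI2 exI[of _ "(\<rho> / 2 - x) / w1"] exI[of _ "(- \<rho> / 2 - x) / w1"])
         (simp add: field_simps)
  next
    case False
    define v where "v = w1 / w2"
    have w1: "w1 = v * w2" using False by (simp add: v_def)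
    have up: ?thesis if "0 < s" "\<bar>x + s * v\<bar> \<le> \<rho> / 2" "y + s \<le> \<rho>" for s
      using that y False \<open>0 < \<rho>\<close> by (intro disjI1 exI[of _ "s / w2"]) (simp add: w1)
    have down: ?thesis if "\<bar>x - s * v\<bar> \<le> \<rho> / 2" "0 \<le> s" "s \<le> \<rho>" "\<rho>\<^sup>2 \<le> (s * v)\<^sup>2 + s\<^sup>2" for s
      using that x y False \<open>0 < \<rho>\<close>
      by (intro disjI2 exI[of _ 0] exI[of _ "- s / w2"]) (simp add: w1)
    \<comment> \<open>The largest step that changes neither coordinate by more than \<open>\<rho>\<close>.\<close>
    define s where "s = \<rho> / max \<bar>v\<bar> 1"
    have s: "0 < s" "s \<le> \<rho>" "s * \<bar>v\<bar> \<le> \<rho>"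
      using \<open>0 < \<rho>\<close> by (auto simp: s_def divide_simps max_def)
    have "\<rho>\<^sup>2 = s\<^sup>2 * (max \<bar>v\<bar> 1)\<^sup>2"
      using \<open>0 < \<rho>\<close> by (simp add: s_def power_divide)
    also have "\<dots> \<le> s\<^sup>2 * (v\<^sup>2 + 1)"
      by (intro mult_left_mono) (auto simp: max_def)
    finally have len: "\<rho>\<^sup>2 \<le> (s * v)\<^sup>2 + s\<^sup>2" by (simp add: algebra_simps power_mult_distrib)
    show ?thesis
    proof (cases "\<bar>x - s * v\<bar> \<le> \<rho> / 2")
      case True
      then show ?thesis using down len s by auto
    next
      case far: False
      show ?thesis
      proof (cases "v > 0")
        case True
        then have "0 < s * v" using s by simp
        moreover have "s * v \<le> \<rho>" using s(3) True by simp
        ultimately have "x < \<rho> / 2" using far x by linarith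
        define e where "e = min ((\<rho> / 2 - x) / v) (\<rho> - y)"
        have "e > 0" using True \<open>x < \<rho> / 2\<close> y by (auto simp: e_def)
        moreover have "e * v \<le> \<rho> / 2 - x"
          using True by (simp add: e_def min_def field_simps)
        moreover have "0 < e * v" using True \<open>e > 0\<close> by simp
        moreover have "y + e \<le> \<rho>" by (simp add: e_def)
        ultimately show ?thesis using x by (intro up[of e]; linarith)
      next
        case False
        have "v \<noteq> 0" using far x by auto
        then have neg: "v < 0" using False by simp
        then have "s * v < 0" using s by (simp add: mult_pos_neg)
        moreover have "- \<rho> \<le> s * v" using s(3) neg by simp
        ultimately have "- \<rho> / 2 < x" using far x by linarith
        define e where "e = min ((\<rho> / 2 + x) / - v) (\<rho> - y)"
        have "e > 0" using neg \<open>- \<rho> / 2 < x\<close> y by (auto simp: e_def divide_simps)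
        moreover have "e * - v \<le> \<rho> / 2 + x"
          using neg by (simp add: e_def min_def field_simps)
        moreover have "0 < e * - v" using neg \<open>e > 0\<close> by (simp add: mult_pos_neg)
        moreover have "y + e \<le> \<rho>" by (simp add: e_def)
        ultimately show ?thesis using x by (intro up[of e]; linarith)
      qed
    qed
  qed
qed

definition centred_rectangle :: "real \<Rightarrow> real \<Rightarrow> (real^2) set" where
  "centred_rectangle a b = {x. \<bar>x $ 1\<bar> \<le> a / 2 \<and> \<bar>x $ 2\<bar> \<le> b / 2}"

lemma centred_rectangle_eq_cbox:
  "centred_rectangle a b = cbox (vector [- a / 2, - b / 2]) (vector [a / 2, b / 2])"
  by (auto simp: centred_rectangle_def mem_box_cart forall_2)

lemma dist_vec2: "(dist x y)\<^sup>2 = (x $ 1 - y $ 1)\<^sup>2 + (x $ 2 - y $ 2)\<^sup>2" for x y :: "real^2"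
  by (simp add: dist_vec_def L2_set_def sum_2 dist_real_def)

text \<open>
  Take a highest point \<open>p\<close> of the cell (lowest for \<open>\<sigma> = - 1\<close>). If it is below the top side, it lies on
  a bisector whose chord is contained in the cell. The chord does not rise above \<open>p\<close>, so by
  \<open>line_in_rectangle\<close> it has length at least \<open>\<rho>\<close>, contrary to \<open>bisector_short\<close>. As the cell contains
  the midpoint of the rectangle, \<open>p\<close> lies in the upper half.
\<close>

lemma cell_reaches_side:
  fixes C :: "(real^2) set"
  assumes "separated_cover \<rho> C (centred_rectangle \<rho> (2 * \<rho>))"
    and c: "c \<in> C" and zero: "0 \<in> separated_cover.voronoi_cell C (centred_rectangle \<rho> (2 * \<rho>)) c"
    and sg: "\<sigma> = 1 \<or> \<sigma> = - 1"
  shows "\<exists>p \<in> separated_cover.voronoi_cell C (centred_rectangle \<rho> (2 * \<rho>)) c. \<sigma> * p $ 2 = \<rho>"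
proof -
  let ?K = "centred_rectangle \<rho> (2 * \<rho>)"
  interpret separated_cover \<rho> C ?K by fact
  have K: "x \<in> ?K \<longleftrightarrow> \<bar>x $ 1\<bar> \<le> \<rho> / 2 \<and> \<bar>\<sigma> * x $ 2\<bar> \<le> \<rho>" for x
    using sg by (auto simp: centred_rectangle_def)
  have "continuous_on (voronoi_cell c) (\<lambda>x. \<sigma> * x $ 2)" by (intro continuous_intros)
  then obtain p where p: "p \<in> voronoi_cell c" and pmax: "\<And>q. q \<in> voronoi_cell c \<Longrightarrow> \<sigma> * q $ 2 \<le> \<sigma> * p $ 2"
    using continuous_attains_sup[OF compact_cell, of c "\<lambda>x. \<sigma> * x $ 2"] zero by blast
  have pK: "p \<in> ?K" using p by (simp add: voronoi_cell_def)
  have p0: "0 \<le> \<sigma> * p $ 2" using pmax[OF zero] by simp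
  have "\<sigma> * p $ 2 = \<rho>"
  proof (rule ccontr)
    assume "\<sigma> * p $ 2 \<noteq> \<rho>"
    then have pr: "\<sigma> * p $ 2 < \<rho>" using pK K by auto
    have "\<exists>c'\<in>C. c \<noteq> c' \<and> dist p c = dist p c'"
    proof (rule cell_boundary_tie[OF c p])
      fix \<epsilon> :: real assume "0 < \<epsilon>"
      define \<delta> where "\<delta> = min (\<epsilon> / 2) (\<rho> - \<sigma> * p $ 2)"
      have d: "0 < \<delta>" "\<delta> < \<epsilon>" "\<delta> \<le> \<rho> - \<sigma> * p $ 2" using \<open>0 < \<epsilon>\<close> pr by (auto simp: \<delta>_def)
      define y :: "real^2" where "y = vector [p $ 1, p $ 2 + \<sigma> * \<delta>]"
      have sy: "\<sigma> * y $ 2 = \<sigma> * p $ 2 + \<delta>" using sg by (auto simp: y_def)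
      have "y \<in> ?K" using pK p0 d sy unfolding K by (auto simp: y_def)
      moreover have "y \<notin> voronoi_cell c" using pmax[of y] sy d by auto
      moreover have "dist p y < \<epsilon>"
      proof -
        have "(dist p y)\<^sup>2 = \<delta>\<^sup>2" using sg by (auto simp: dist_vec2 y_def)
        then show ?thesis using d by (simp add: power2_eq_iff_nonneg)
      qed
      ultimately show "\<exists>y\<in>?K - voronoi_cell c. dist p y < \<epsilon>" by blast
    qed
    then obtain c' where c': "c' \<in> C" "c \<noteq> c'" "dist p c = dist p c'" by blast
    \<comment> \<open>The direction \<open>(w1, w2)\<close> is orthogonal to \<open>c - c'\<close>, so \<open>l\<close> parametrizes the bisector.\<close>
    define w1 where "w1 = c $ 2 - c' $ 2"
    define w2 where "w2 = c' $ 1 - c $ 1"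
    define l :: "real \<Rightarrow> real^2" where "l s = vector [p $ 1 + s * w1, p $ 2 + s * w2]" for s
    have lbis: "dist (l s) c = dist (l s) c'" for s
    proof -
      have "(dist (l s) c)\<^sup>2 - (dist (l s) c')\<^sup>2 = (dist p c)\<^sup>2 - (dist p c')\<^sup>2"
        unfolding dist_vec2 by (simp add: l_def w1_def w2_def) algebra
      then show ?thesis using c'(3) by (simp add: power2_eq_iff_nonneg)
    qed
    have "w1 \<noteq> 0 \<or> \<sigma> * w2 \<noteq> 0"
      using c'(2) sg by (auto simp: w1_def w2_def vec_eq_iff forall_2)
    moreover have sl: "\<sigma> * l s $ 2 = \<sigma> * p $ 2 + s * (\<sigma> * w2)" for s
      by (simp add: l_def algebra_simps)
    have lK: "l s \<in> ?K \<longleftrightarrow> \<bar>p $ 1 + s * w1\<bar> \<le> \<rho> / 2 \<and> \<bar>\<sigma> * p $ 2 + s * (\<sigma> * w2)\<bar> \<le> \<rho>" for s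
      unfolding K sl by (simp add: l_def)
    have ldist: "(dist (l s) (l s'))\<^sup>2 = ((s - s') * w1)\<^sup>2 + ((s - s') * (\<sigma> * w2))\<^sup>2" for s s'
      using sg by (auto simp: dist_vec2 l_def algebra_simps power2_commute)
    ultimately consider s where "l s \<in> ?K" "\<sigma> * p $ 2 < \<sigma> * l s $ 2"
      | s s' where "l s \<in> ?K" "l s' \<in> ?K" "\<rho>\<^sup>2 \<le> (dist (l s) (l s'))\<^sup>2"
      using line_in_rectangle[OF rho_pos _ p0 pr, of "p $ 1" w1 "\<sigma> * w2"] pK[unfolded K]
      unfolding lK sl ldist by blast
    then show False
    proof cases
      case 1
      then show False
        using pmax[OF bisector_in_cell[OF c c'(1,2) p c'(3) _ lbis]] by fastforce
    next
      case 2
      then have "dist (l s) (l s') < \<rho>"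
        using bisector_short[OF c c'(1,2) p c'(3) _ lbis _ lbis] by blast
      then show False using 2(3) power_strict_mono[of "dist (l s) (l s')" \<rho> 2] by simp
    qed
  qed
  then show ?thesis using p by blast
qed

text \<open>
  The Voronoi cell of the midpoint would reach from one short side to the other, so it would have
  diameter at least \<open>2 * \<rho>\<close> inside an open ball of radius \<open>\<rho>\<close>.
\<close>

theorem separated_disks_leave_hole:
  fixes C :: "(real^2) set"
  assumes "0 < \<rho>"
    and separated: "\<And>c c'. c \<in> C \<Longrightarrow> c' \<in> C \<Longrightarrow> c \<noteq> c' \<Longrightarrow> sqrt 3 * \<rho> \<le> dist c c'"
  shows "\<exists>x \<in> centred_rectangle \<rho> (2 * \<rho>). \<forall>c\<in>C. \<rho> \<le> dist x c"
proof (rule ccontr)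
  assume "\<not> ?thesis"
  then interpret separated_cover \<rho> C "centred_rectangle \<rho> (2 * \<rho>)"
    using assms by unfold_locales (auto simp: centred_rectangle_eq_cbox not_le)
  have "0 \<in> centred_rectangle \<rho> (2 * \<rho>)" using rho_pos by (simp add: centred_rectangle_def)
  then obtain c where c: "c \<in> C" "0 \<in> voronoi_cell c" using ex_cell by blast
  obtain p where p: "p \<in> voronoi_cell c" "p $ 2 = \<rho>"
    using cell_reaches_side[OF separated_cover_axioms c, of 1] by auto
  obtain q where q: "q \<in> voronoi_cell c" "q $ 2 = - \<rho>"
    using cell_reaches_side[OF separated_cover_axioms c, of "- 1"] by fastforce
  have "\<bar>p $ 2 - q $ 2\<bar> \<le> dist p q"
    using component_le_norm_cart[of "p - q" 2] by (simp add: dist_norm)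
  then show False
    using p q dist_cell_less[OF p(1)] dist_cell_less[OF q(1)] dist_triangle2[of p q c] rho_pos by simp
qed

section \<open>The hexagonal lattice\<close>

text \<open>
  In coordinates with respect to two unit vectors at an angle of 60 degrees, the squared norm is
  \<open>u\<^sup>2 + u * v + v\<^sup>2\<close>. Averaging the squared distances from \<open>(f, g)\<close> to the vertices \<open>(0, 0)\<close>,
  \<open>(1, 0)\<close>, \<open>(0, 1)\<close> with the barycentric coordinates of \<open>(f, g)\<close> as weights gives at most \<open>1 / 3\<close>,
  so one of them is at most \<open>1 / 3\<close>.
\<close>

lemma triangle_vertex_close:
  fixes f g :: real
  assumes "0 \<le> f" "0 \<le> g" "f + g \<le> 1"
  shows "\<exists>i j :: int. (f - of_int i)\<^sup>2 + (f - of_int i) * (g - of_int j) + (g - of_int j)\<^sup>2 \<le> 1 / 3"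
proof (rule ccontr)
  let ?N = "\<lambda>i j. (f - i)\<^sup>2 + (f - i) * (g - j) + (g - j)\<^sup>2"
  assume "\<not> ?thesis"
  then have "1 / 3 < ?N (real_of_int i) (real_of_int j)" for i j by (simp add: not_le)
  from this[of 0 0] this[of 1 0] this[of 0 1]
  have far: "1 / 3 < ?N 0 0" "1 / 3 < ?N 1 0" "1 / 3 < ?N 0 1" by simp_all
  have "(1 - f - g) * (1 / 3) + f * (1 / 3) + g * (1 / 3)
      < (1 - f - g) * ?N 0 0 + f * ?N 1 0 + g * ?N 0 1"
  proof -
    have "(1 - f - g) * (1 / 3) \<le> (1 - f - g) * ?N 0 0" "f * (1 / 3) \<le> f * ?N 1 0" "g * (1 / 3) \<le> g * ?N 0 1"
      using far assms by (intro mult_left_mono; simp)+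
    moreover have "f > 0 \<or> g > 0 \<or> 1 - f - g > 0" using assms by linarith
    then have "(1 - f - g) * (1 / 3) < (1 - f - g) * ?N 0 0 \<or> f * (1 / 3) < f * ?N 1 0 \<or> g * (1 / 3) < g * ?N 0 1"
      using far by (meson mult_strict_left_mono)
    ultimately show ?thesis by linarith
  qed
  also have "\<dots> = f + g - f\<^sup>2 - f * g - g\<^sup>2"
    by (simp add: power2_eq_square algebra_simps)
  also have "\<dots> = 1 / 3 - ((f + g / 2 - 1 / 2)\<^sup>2 + 3 * (g / 2 - 1 / 6)\<^sup>2)"
    by (simp add: power2_eq_square algebra_simps)
  also have "\<dots> \<le> 1 / 3" by (smt (verit) zero_le_power2)
  finally show False by (simp add: field_simps)
qed

text \<open>
  The triangles of the lattice have circumradius \<open>d / sqrt 3\<close>. In lattice coordinates, a fundamental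
  parallelogram consists of two triangles, which a point reflection exchanges.
\<close>

lemma hex_lattice_close:
  assumes "0 < d"
  shows "\<exists>y \<in> hex_lattice d. dist x y \<le> d / sqrt 3"
proof -
  define \<beta> where "\<beta> = 2 * x $ 2 / (sqrt 3 * d)"
  define \<alpha> where "\<alpha> = x $ 1 / d - \<beta> / 2"
  have x1: "x $ 1 = d * (\<alpha> + \<beta> / 2)" and x2: "x $ 2 = d * (sqrt 3 / 2 * \<beta>)"
    using assms by (simp_all add: \<alpha>_def \<beta>_def field_simps)
  have "\<exists>a b. (\<alpha> - of_int a)\<^sup>2 + (\<alpha> - of_int a) * (\<beta> - of_int b) + (\<beta> - of_int b)\<^sup>2 \<le> 1 / 3"
  proof (cases "frac \<alpha> + frac \<beta> \<le> 1")
    case True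
    then obtain i j :: int where
      "(frac \<alpha> - i)\<^sup>2 + (frac \<alpha> - i) * (frac \<beta> - j) + (frac \<beta> - j)\<^sup>2 \<le> 1 / 3"
      using triangle_vertex_close[of "frac \<alpha>" "frac \<beta>"] frac_ge_0 by blast
    then show ?thesis
      by (intro exI[of _ "\<lfloor>\<alpha>\<rfloor> + i"] exI[of _ "\<lfloor>\<beta>\<rfloor> + j"]) (simp add: frac_def algebra_simps)
  next
    case False
    then obtain i j :: int where
      "(1 - frac \<alpha> - i)\<^sup>2 + (1 - frac \<alpha> - i) * (1 - frac \<beta> - j) + (1 - frac \<beta> - j)\<^sup>2 \<le> 1 / 3"
      using triangle_vertex_close[of "1 - frac \<alpha>" "1 - frac \<beta>"] frac_lt_1[of \<alpha>] frac_lt_1[of \<beta>]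
    by (smt (verit))
    then show ?thesis
      by (intro exI[of _ "\<lfloor>\<alpha>\<rfloor> + 1 - i"] exI[of _ "\<lfloor>\<beta>\<rfloor> + 1 - j"])
         (simp add: frac_def power2_eq_square algebra_simps)
  qed
  then obtain a b :: int
    where ab: "(\<alpha> - a)\<^sup>2 + (\<alpha> - a) * (\<beta> - b) + (\<beta> - b)\<^sup>2 \<le> 1 / 3" by blast
  define y :: "real^2" where
    "y = of_int a *\<^sub>R vector [d, 0] + of_int b *\<^sub>R vector [d / 2, sqrt 3 * d / 2]"
  have "y \<in> hex_lattice d" unfolding hex_lattice_def y_def by blast
  moreover have "dist x y \<le> d / sqrt 3"
  proof (rule power2_le_imp_le)
    have "(dist x y)\<^sup>2 = (d * ((\<alpha> - a) + (\<beta> - b) / 2))\<^sup>2 + (d * (sqrt 3 / 2 * (\<beta> - b)))\<^sup>2"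
      unfolding dist_vec2 x1 x2 by (simp add: y_def algebra_simps diff_divide_distrib)
    also have "\<dots> = d\<^sup>2 * ((\<alpha> - a)\<^sup>2 + (\<alpha> - a) * (\<beta> - b) + (\<beta> - b)\<^sup>2)"
    proof -
      have "(sqrt 3)\<^sup>2 = (3::real)" by simp
      then show ?thesis by (simp only: power_mult_distrib power_divide) (simp add: power2_eq_square field_simps)
    qed
    also have "\<dots> \<le> d\<^sup>2 * (1 / 3)" using ab by (intro mult_left_mono) auto
    also have "\<dots> = (d / sqrt 3)\<^sup>2" by (simp add: power_divide)
    finally show "(dist x y)\<^sup>2 \<le> (d / sqrt 3)\<^sup>2" .
  qed (use assms in simp)
  ultimately show ?thesis by blast
qed

text \<open>
  The upper bound is what \<open>4 / 15 < sqrt 3 * r = 2 - sqrt 3\<close> requires.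
\<close>

lemma sqrt_3_bounds: "5 / 3 < sqrt 3" "sqrt 3 < 26 / 15"
  by (rule real_less_rsqrt, simp add: power2_eq_square)
     (rule real_less_lsqrt, simp_all add: power2_eq_square)

text \<open>
  In units of \<open>1 / 15\<close>, the shifted lattice point with coefficients \<open>a\<close>, \<open>b\<close> has the odd first
  coordinate \<open>4 * a + 2 * b + 1\<close>, and the rectangle allows absolute values up to
  \<open>15 * (sqrt 3 - 1)\<close>, between 10 and 11. In every row this leaves five of the ten odd numbers from
  -9 to 9, those in one residue class modulo 4. The eleven rows with \<open>\<bar>b\<bar> \<le> 5\<close> fit.
\<close>

lemma card_shifted_hex_lattice:
  assumes r: "r = 2 / sqrt 3 - 1"
  shows "card (centred_rectangle (1 + 3 * r) (2 + 4 * r)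
      \<inter> (\<lambda>x. x + vector [1 / 15, 0]) ` hex_lattice (4 / 15)) = 55"
proof -
  \<comment> \<open>Within row \<open>b\<close> the points are numbered by \<open>k = a + (b + 1) div 2\<close>. Fifteen times the first
    coordinate is then \<open>4 * k + 1\<close> or \<open>4 * k - 1\<close> according to the parity of \<open>b\<close>, so that the same range of \<open>k\<close>
    fits for all rows.\<close>
  define \<phi> :: "int \<times> int \<Rightarrow> real^2"
    where "\<phi> = (\<lambda>(k, b). vector [of_int (4 * (k - (b + 1) div 2) + 2 * b + 1) / 15, 2 * sqrt 3 * b / 15])"
  have "2 / sqrt 3 = 2 * sqrt 3 / 3" by (simp add: field_simps)
  then have width: "(1 + 3 * r) / 2 = sqrt 3 - 1" and height: "(2 + 4 * r) / 2 = 4 * sqrt 3 / 3 - 1"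
    by (simp_all add: r)
  have "centred_rectangle (1 + 3 * r) (2 + 4 * r) \<inter> (\<lambda>x. x + vector [1 / 15, 0]) ` hex_lattice (4 / 15)
      = \<phi> ` ({- 2..2} \<times> {- 5..5})"
  proof -
    have pt: "of_int a *\<^sub>R vector [4 / 15, 0] + of_int b *\<^sub>R vector [4 / 15 / 2, sqrt 3 * (4 / 15) / 2]
        + vector [1 / 15, 0] = \<phi> (a + (b + 1) div 2, b)" for a b :: int
      by (simp add: \<phi>_def vec_eq_iff forall_2 field_simps)
    have "(\<lambda>x. x + vector [1 / 15, 0]) ` hex_lattice (4 / 15) = range (\<lambda>(a, b). \<phi> (a + (b + 1) div 2, b))"
    proof -
      have "hex_lattice (4 / 15) = range (\<lambda>(a, b). of_int a *\<^sub>R vector [4 / 15, 0]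
          + of_int b *\<^sub>R vector [4 / 15 / 2, sqrt 3 * (4 / 15) / 2])"
        unfolding hex_lattice_def by force
      then show ?thesis by (simp only: image_image case_prod_unfold pt)
    qed
    also have "\<dots> = range \<phi>"
    proof -
      have "\<phi> m \<in> range (\<lambda>(a, b). \<phi> (a + (b + 1) div 2, b))" for m
        using rangeI[of "\<lambda>(a, b). \<phi> (a + (b + 1) div 2, b)" "(fst m - (snd m + 1) div 2, snd m)"]
        by (simp only: prod.case fst_conv snd_conv diff_add_cancel prod.collapse)
      then show ?thesis by (intro equalityI subsetI) (auto simp only: case_prod_unfold)
    qed
    finally have lat: "(\<lambda>x. x + vector [1 / 15, 0]) ` hex_lattice (4 / 15) = range \<phi>" .
    have "\<phi> (k, b) \<in> centred_rectangle (1 + 3 * r) (2 + 4 * r) \<longleftrightarrow> k \<in> {- 2..2} \<and> b \<in> {- 5..5}" for k b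
    proof -
      define n where "n = 4 * (k - (b + 1) div 2) + 2 * b + 1"
      have x12: "\<phi> (k, b) $ 1 = of_int n / 15" "\<phi> (k, b) $ 2 = 2 * sqrt 3 * of_int b / 15"
        by (simp_all add: \<phi>_def n_def)
      have "\<bar>of_int n / 15\<bar> \<le> (1 + 3 * r) / 2 \<longleftrightarrow> \<bar>n\<bar> \<le> 10"
      proof -
        have "\<bar>real_of_int n / 15\<bar> = of_int \<bar>n\<bar> / 15" by simp
        moreover have "real_of_int \<bar>n\<bar> / 15 \<le> (1 + 3 * r) / 2" if "\<bar>n\<bar> \<le> 10"
        proof -
          have "real_of_int \<bar>n\<bar> \<le> 10" using that by linarith
          then show ?thesis using sqrt_3_bounds unfolding width height by linarith
        qed
        moreover have "(1 + 3 * r) / 2 < real_of_int \<bar>n\<bar> / 15" if "11 \<le> \<bar>n\<bar>"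
        proof -
          have "11 \<le> real_of_int \<bar>n\<bar>" using that by linarith
          then show ?thesis using sqrt_3_bounds unfolding width height by linarith
        qed
        moreover have "\<bar>n\<bar> \<le> 10 \<or> 11 \<le> \<bar>n\<bar>" by linarith
        ultimately show ?thesis by (metis not_le)
      qed
      also have "\<bar>n\<bar> \<le> 10 \<longleftrightarrow> k \<in> {- 2..2}"
      proof -
        have "n = 4 * k + 1 - 2 * (b mod 2)"
        proof -
          have "2 * ((b + 1) div 2) = b + b mod 2" by presburger
          then show ?thesis by (simp add: n_def)
        qed
        moreover have "b mod 2 = 0 \<or> b mod 2 = 1" by presburger
        ultimately show ?thesis by auto
      qed
      finally have hor: "\<bar>of_int n / 15\<bar> \<le> (1 + 3 * r) / 2 \<longleftrightarrow> k \<in> {- 2..2}" .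
      have ver: "\<bar>2 * sqrt 3 * of_int b / 15\<bar> \<le> (2 + 4 * r) / 2 \<longleftrightarrow> b \<in> {- 5..5}"
      proof -
        have "\<bar>2 * sqrt 3 * of_int b / 15\<bar> = 2 * sqrt 3 * of_int \<bar>b\<bar> / 15"
          by (simp add: abs_mult)
        moreover have "2 * sqrt 3 * of_int \<bar>b\<bar> / 15 \<le> (2 + 4 * r) / 2" if "\<bar>b\<bar> \<le> 5"
        proof -
          have "real_of_int \<bar>b\<bar> \<le> 5" using that by linarith
          then have "2 * sqrt 3 * real_of_int \<bar>b\<bar> \<le> 2 * sqrt 3 * 5" by (intro mult_left_mono) auto
          then show ?thesis using sqrt_3_bounds unfolding width height by linarith
        qed
        moreover have "(2 + 4 * r) / 2 < 2 * sqrt 3 * of_int \<bar>b\<bar> / 15" if "6 \<le> \<bar>b\<bar>"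
        proof -
          have "6 \<le> real_of_int \<bar>b\<bar>" using that by linarith
          then have "2 * sqrt 3 * 6 \<le> 2 * sqrt 3 * real_of_int \<bar>b\<bar>" by (intro mult_left_mono) auto
          then show ?thesis using sqrt_3_bounds unfolding width height by linarith
        qed
        moreover have "\<bar>b\<bar> \<le> 5 \<or> 6 \<le> \<bar>b\<bar>" "b \<in> {- 5..5} \<longleftrightarrow> \<bar>b\<bar> \<le> 5" by auto
        ultimately show ?thesis by (metis not_le)
      qed
      show ?thesis unfolding centred_rectangle_def mem_Collect_eq x12 hor ver ..
    qed
    then show ?thesis unfolding lat by force
  qed
  moreover have "inj \<phi>"
    by (rule injI) (auto simp: \<phi>_def vec_eq_iff forall_2)
  ultimately show ?thesis
    by (simp add: card_image inj_on_subset card_cartesian_product)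
qed

section \<open>Moving the rectangle and the packing\<close>

text \<open>
  The side directions can be taken positively oriented, since a rectangle is symmetric under
  reversing one of them about its centre. The two sides are exchanged because the rows of
  \<open>hex_lattice\<close> are parallel to the first axis and have to run along the second side of \<open>R\<close>.
\<close>

lemma closed_rectangle_eq_rigid_image:
  assumes "closed_rectangle a b R"
  shows "\<exists>A z. rotation_matrix A \<and> R = (\<lambda>x. A *v x + z) ` centred_rectangle b a"
proof -
  obtain p u v where uv: "norm u = 1" "norm v = 1" "orthogonal u v"
    and R: "R = {p + s *\<^sub>R u + t *\<^sub>R v | s t. s \<in> {0..a} \<and> t \<in> {0..b}}"
    using assms unfolding closed_rectangle_def by blast
  have u: "(u $ 1)\<^sup>2 + (u $ 2)\<^sup>2 = 1" and v: "(v $ 1)\<^sup>2 + (v $ 2)\<^sup>2 = 1"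
    and ort: "u $ 1 * v $ 1 + u $ 2 * v $ 2 = 0"
    using uv by (simp_all add: norm_eq_1 orthogonal_def inner_vec_def sum_2 power2_eq_square)
  \<comment> \<open>The orientation of the basis \<open>(v, u)\<close>; multiplying \<open>u\<close> by it makes the basis positive.\<close>
  define \<delta> where "\<delta> = v $ 1 * u $ 2 - u $ 1 * v $ 2"
  have "\<delta>\<^sup>2 = ((u $ 1)\<^sup>2 + (u $ 2)\<^sup>2) * ((v $ 1)\<^sup>2 + (v $ 2)\<^sup>2) - (u $ 1 * v $ 1 + u $ 2 * v $ 2)\<^sup>2"
    unfolding \<delta>_def by algebra
  then have d2: "\<delta>\<^sup>2 = 1" using u v ort by simp
  then have d: "\<delta> = 1 \<or> \<delta> = - 1" by (simp add: power2_eq_1_iff)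
  define A :: "real^2^2" where "A = vector [vector [v $ 1, \<delta> * u $ 1], vector [v $ 2, \<delta> * u $ 2]]"
  define z where "z = p + (a / 2) *\<^sub>R u + (b / 2) *\<^sub>R v"
  have Ax: "A *v x = x $ 1 *\<^sub>R v + (\<delta> * x $ 2) *\<^sub>R u" for x
    by (simp add: A_def matrix_vector_mult_def vec_eq_iff forall_2 sum_2 algebra_simps)
  have "det A = \<delta> * \<delta>" by (simp add: A_def det_2 \<delta>_def algebra_simps)
  moreover have "orthogonal_matrix A"
    using u v ort d2
    by (simp add: orthogonal_matrix A_def matrix_matrix_mult_def transpose_def mat_def vec_eq_iff
        forall_2 sum_2 power2_eq_square algebra_simps) (use d in auto)
  ultimately have "rotation_matrix A" using d2 by (simp add: rotation_matrix_def power2_eq_square)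
  moreover have "R = (\<lambda>x. A *v x + z) ` centred_rectangle b a"
  proof (intro equalityI subsetI)
    fix y assume "y \<in> R"
    then obtain s t where st: "s \<in> {0..a}" "t \<in> {0..b}" "y = p + s *\<^sub>R u + t *\<^sub>R v" unfolding R by blast
    define x :: "real^2" where "x = vector [t - b / 2, \<delta> * (s - a / 2)]"
    have "\<bar>t - b / 2\<bar> \<le> b / 2" "\<bar>s - a / 2\<bar> \<le> a / 2"
      using st(1,2) unfolding atLeastAtMost_iff by linarith+
    moreover have "\<bar>\<delta> * (s - a / 2)\<bar> = \<bar>s - a / 2\<bar>" using d by auto
    ultimately have "x \<in> centred_rectangle b a" by (simp add: x_def centred_rectangle_def)
    moreover have "y = A *v x + z"
      using d unfolding Ax by (auto simp: x_def st z_def algebra_simps)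
    ultimately show "y \<in> (\<lambda>x. A *v x + z) ` centred_rectangle b a" by blast
  next
    fix y assume "y \<in> (\<lambda>x. A *v x + z) ` centred_rectangle b a"
    then obtain x where x: "x \<in> centred_rectangle b a" "y = A *v x + z" by blast
    have "y = p + (a / 2 + \<delta> * x $ 2) *\<^sub>R u + (b / 2 + x $ 1) *\<^sub>R v"
      unfolding x(2) Ax z_def by (simp add: algebra_simps)
    moreover have "a / 2 + \<delta> * x $ 2 \<in> {0..a}" "b / 2 + x $ 1 \<in> {0..b}"
      using x d by (auto simp: centred_rectangle_def abs_le_iff)
    ultimately show "y \<in> R" unfolding R by blast
  qed
  ultimately show ?thesis by blast
qed

lemma packing_centres_separated:
  assumes P: "unit_disk_packing P" and c: "cball c 1 \<in> P" "cball c' 1 \<in> P" "c \<noteq> c'"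
  shows "2 \<le> dist c c'"
proof (rule ccontr)
  assume "\<not> ?thesis"
  then have "midpoint c c' \<in> ball c 1 \<inter> ball c' 1"
    by (simp add: dist_midpoint)
  moreover have "cball c 1 \<noteq> cball c' 1" using c(3) by (simp add: cball_eq_cball_iff)
  then have "interior (cball c 1) \<inter> interior (cball c' 1) = {}"
    using P c unfolding unit_disk_packing_def pairwise_def by blast
  ultimately show False unfolding interior_cball by blast
qed

theorem theorem3p4:
  fixes r :: real and R :: "(real^2) set"
  assumes "r = 2 / sqrt 3 - 1"
    and "closed_rectangle (2 + 4 * r) (1 + 3 * r) R"
  shows "\<exists>d g. 0 < d \<and> d < sqrt 3 * r \<and> rigid_motion g \<and>
           card (R \<inter> g ` hex_lattice d) = 55 \<and>
           (\<forall>P. unit_disk_packing P \<longrightarrow>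
              (\<exists>x \<in> R \<inter> g ` hex_lattice d. \<forall>D\<in>P. x \<notin> D))"
proof -
  let ?K = "centred_rectangle (1 + 3 * r) (2 + 4 * r)"
  obtain A z where A: "rotation_matrix A" and R: "R = (\<lambda>x. A *v x + z) ` ?K"
    using closed_rectangle_eq_rigid_image[OF assms(2)] by blast
  define d :: real where "d = 4 / 15"
  define e :: "real^2" where "e = vector [1 / 15, 0]"
  define G where "G x = A *v x + z" for x
  define g where "g x = A *v x + (A *v e + z)" for x
  let ?L = "(\<lambda>x. x + e) ` hex_lattice d"
  have gG: "g x = G (x + e)" for x
    by (simp add: g_def G_def matrix_vector_right_distrib)
  have distG: "dist (G x) (G y) = dist x y" for x y
  proof -
    have "orthogonal_transformation ((*v) A)"
      using A by (simp add: rotation_matrix_def orthogonal_transformation_matrix)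
    then show ?thesis by (simp add: G_def orthogonal_transformation_isometry)
  qed
  have injG: "inj G" by (rule injI) (metis distG dist_eq_0_iff)
  have surjG: "\<exists>x. G x = y" for y
  proof -
    have "A ** transpose A = mat 1" using A by (simp add: rotation_matrix_def orthogonal_matrix_def)
    then have "G (transpose A *v (y - z)) = y" unfolding G_def matrix_vector_mul_assoc by simp
    then show ?thesis by blast
  qed
  have X: "R \<inter> g ` hex_lattice d = G ` (?K \<inter> ?L)"
    unfolding R gG image_Int[OF injG] by (simp add: G_def image_image)
  have d: "0 < d" "d < sqrt 3 * r"
    using sqrt_3_bounds by (simp_all add: d_def assms(1) algebra_simps)
  have "rigid_motion g" unfolding rigid_motion_def using A g_def by blast
  moreover have "card (R \<inter> g ` hex_lattice d) = 55"
    using card_shifted_hex_lattice[OF assms(1)] injG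
    unfolding X by (simp add: card_image inj_on_subset d_def e_def)
  moreover have "\<exists>x \<in> R \<inter> g ` hex_lattice d. \<forall>D\<in>P. x \<notin> D" if P: "unit_disk_packing P" for P
  proof -
    define C where "C = {c. cball (G c) 1 \<in> P}"
    have rpos: "0 < 1 + r" using assms(1) by simp
    have "sqrt 3 * (1 + r) \<le> dist c c'" if "c \<in> C" "c' \<in> C" "c \<noteq> c'" for c c'
      using packing_centres_separated[OF P, of "G c" "G c'"] that injG
      by (simp add: C_def distG inj_eq assms(1))
    then obtain x where x: "x \<in> centred_rectangle (1 + r) (2 * (1 + r))"
      and far: "\<And>c. c \<in> C \<Longrightarrow> 1 + r \<le> dist x c"
      using separated_disks_leave_hole[OF rpos, of C] by blast
    obtain y' where "y' \<in> hex_lattice d" "dist (x - e) y' \<le> d / sqrt 3"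
      using hex_lattice_close[OF d(1)] by blast
    moreover define y where "y = y' + e"
    ultimately have y: "y \<in> ?L" "dist x y \<le> d / sqrt 3"
      by (auto simp: dist_norm algebra_simps)
    have "d / sqrt 3 < r" using d(2) by (simp add: field_simps)
    then have xy: "dist x y < r" using y by simp
    have "\<bar>x $ i - y $ i\<bar> \<le> dist x y" for i
      using component_le_norm_cart[of "x - y" i] by (simp add: dist_norm)
    then have "\<bar>x $ i - y $ i\<bar> < r" for i using xy by (meson le_less_trans)
    from this[of 1] this[of 2] have "y \<in> ?K"
      using x by (auto simp: centred_rectangle_def field_simps abs_if split: if_splits)
    then have "G y \<in> R \<inter> g ` hex_lattice d" using y X by blast
    moreover have "G y \<notin> D" if "D \<in> P" for D
    proof -
      have "unit_disk D" using P that by (simp add: unit_disk_packing_def)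
      then obtain c' where c': "D = cball c' 1" unfolding unit_disk_def ..
      obtain c where "G c = c'" using surjG ..
      then have D: "D = cball (G c) 1" "c \<in> C" using that c' by (simp_all add: C_def)
      have "1 < dist y c" using far[OF D(2)] xy dist_triangle[of x c y] by linarith
      then show ?thesis by (simp add: D distG dist_commute)
    qed
    ultimately show ?thesis by blast
  qed
  ultimately show ?thesis using d by blast
qed

end
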